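(* Let the origin demand and destination supply be constant, $\delta(t)=\delta$ and $\sigma(t)=\sigma$, and let $\epsilon>0$ satisfy $\epsilon\le\frac{\Lambda}{\max\{\delta,\sigma\}}$. The four approximate point queue models have the following (different) stationary states: 1. When $\delta>\sigma$: $\lambda_\epsilon=\Lambda$ in $\epsilon$-PQM1 and $\epsilon$-PQM4, and $\lambda_\epsilon=\Lambda-\epsilon\sigma$ in $\epsilon$-PQM2 and $\epsilon$-PQM3. 2. When $\delta<\sigma$: $\lambda_\epsilon=0$ in $\epsilon$-PQM1 and $\epsilon$-PQM3, and $\lambda_\epsilon=\epsilon\delta$ in $\epsilon$-PQM2 and $\epsilon$-PQM4. 3. When $\delta=\sigma$: $\lambda_\epsilon\in[0,\Lambda]$ in $\epsilon$-PQM1, $\lambda_\epsilon\in[\epsilon\delta,\Lambda-\epsilon\sigma]$ in $\epsilon$-PQM2, $\lambda_\epsilon\in[0,\Lambda-\epsilon\sigma]$ in $\epsilon$-PQM3, and $\lambda_\epsilon\in[\epsilon\delta,\Lambda]$ in $\epsilon$-PQM4.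
   Context: A point queue has storage capacity $\Lambda>0$, constant origin demand $\delta\ge0$ and constant destination supply $\sigma\ge0$. In the approximate models the queue size $\lambda_\epsilon(t)\in[0,\Lambda]$ evolves by $$\frac{d}{dt}\lambda_\epsilon(t)=\min\{\delta,s_\epsilon(t)\}-\min\{d_\epsilon(t),\sigma\},$$ with demand $d_\epsilon$ and supply $s_\epsilon$ given by: - $\epsilon$-PQM1: $d_\epsilon=\delta+\frac{\lambda_\epsilon}{\epsilon}$, $s_\epsilon=\sigma+\frac{\Lambda-\lambda_\epsilon}{\epsilon}$; - $\epsilon$-PQM2: $d_\epsilon=\frac{\lambda_\epsilon}{\epsilon}$, $s_\epsilon=\frac{\Lambda-\lambda_\epsilon}{\epsilon}$; - $\epsilon$-PQM3: $d_\epsilon=\delta+\frac{\lambda_\epsilon}{\epsilon}$, $s_\epsilon=\frac{\Lambda-\lambda_\epsilon}{\epsilon}$; - $\epsilon$-PQM4: $d_\epsilon=\frac{\lambda_\epsilon}{\epsilon}$, $s_\epsilon=\sigma+\frac{\Lambda-\lambda_\epsilon}{\epsilon}$. A stationary state is a constant solution $\lambda_\epsilon(t)=\lambda_\epsilon\in[0,\Lambda]$, i.e. a solution of $\min\{\delta,s_\epsilon\}=\min\{d_\epsilon,\sigma\}$.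
   Formalization: The ε-PQM2 claims are proved under the extra condition 2ε·min{δ,σ} ≤ Λ; without it they fail, e.g. for Λ=ε=δ=1, σ=3/4 the state Λ−εσ=1/4 is not stationary. When δ=σ=0 the bound on ε is read as no restriction. *)

theory Defs
  imports Complex_Main
begin

datatype pqm = PQM1 | PQM2 | PQM3 | PQM4

text \<open>Arguments in order: storage capacity \<open>\<Lambda>\<close>, parameter \<open>\<epsilon>\<close>, origin demand \<open>\<delta>\<close>,
  destination supply \<open>\<sigma>\<close>, queue size.\<close>

fun queue_demand :: "pqm \<Rightarrow> real \<Rightarrow> real \<Rightarrow> real \<Rightarrow> real \<Rightarrow> real \<Rightarrow> real" where
  "queue_demand PQM1 \<Lambda> \<epsilon> \<delta> \<sigma> l = \<delta> + l / \<epsilon>"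
| "queue_demand PQM2 \<Lambda> \<epsilon> \<delta> \<sigma> l = l / \<epsilon>"
| "queue_demand PQM3 \<Lambda> \<epsilon> \<delta> \<sigma> l = \<delta> + l / \<epsilon>"
| "queue_demand PQM4 \<Lambda> \<epsilon> \<delta> \<sigma> l = l / \<epsilon>"

fun queue_supply :: "pqm \<Rightarrow> real \<Rightarrow> real \<Rightarrow> real \<Rightarrow> real \<Rightarrow> real \<Rightarrow> real" where
  "queue_supply PQM1 \<Lambda> \<epsilon> \<delta> \<sigma> l = \<sigma> + (\<Lambda> - l) / \<epsilon>"
| "queue_supply PQM2 \<Lambda> \<epsilon> \<delta> \<sigma> l = (\<Lambda> - l) / \<epsilon>"
| "queue_supply PQM3 \<Lambda> \<epsilon> \<delta> \<sigma> l = (\<Lambda> - l) / \<epsilon>"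
| "queue_supply PQM4 \<Lambda> \<epsilon> \<delta> \<sigma> l = \<sigma> + (\<Lambda> - l) / \<epsilon>"

text \<open>Solutions live on the time axis \<open>[0, \<infinity>)\<close>; the derivative at time 0 is one-sided.\<close>

definition pqm_solution :: "pqm \<Rightarrow> real \<Rightarrow> real \<Rightarrow> real \<Rightarrow> real \<Rightarrow> (real \<Rightarrow> real) \<Rightarrow> bool" where
  "pqm_solution m \<Lambda> \<epsilon> \<delta> \<sigma> q \<longleftrightarrow>
     (\<forall>t\<ge>0. q t \<in> {0..\<Lambda>} \<and>
        (q has_real_derivative
           min \<delta> (queue_supply m \<Lambda> \<epsilon> \<delta> \<sigma> (q t)) - min (queue_demand m \<Lambda> \<epsilon> \<delta> \<sigma> (q t)) \<sigma>)
        (at t within {0..}))"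

definition stationary_states :: "pqm \<Rightarrow> real \<Rightarrow> real \<Rightarrow> real \<Rightarrow> real \<Rightarrow> real set" where
  "stationary_states m \<Lambda> \<epsilon> \<delta> \<sigma> = {l. pqm_solution m \<Lambda> \<epsilon> \<delta> \<sigma> (\<lambda>t. l)}"

text \<open>Two points about hypotheses on \<open>\<epsilon>\<close> in the theorem on stationary states.

  The bound \<open>\<epsilon> \<le> \<Lambda> / max \<delta> \<sigma>\<close> is no restriction when \<open>\<delta> = \<sigma> = 0\<close>. It is therefore
  guarded by \<open>max \<delta> \<sigma> > 0\<close>, because division by zero yields zero in HOL.

  The bound does not suffice for PQM2. For \<open>\<Lambda> = \<epsilon> = \<delta> = \<sigma> = 1\<close> the interval
  \<open>[\<epsilon> \<delta>, \<Lambda> - \<epsilon> \<sigma>] = [1, 0]\<close> is empty although \<open>1/2\<close> is stationary, and for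
  \<open>\<Lambda> = \<epsilon> = \<delta> = 1\<close>, \<open>\<sigma> = 3/4\<close> the state \<open>\<Lambda> - \<epsilon> \<sigma> = 1/4\<close> is not stationary.
  The PQM2 claims carry the extra premise \<open>2 * \<epsilon> * min \<delta> \<sigma> \<le> \<Lambda>\<close>, which is necessary
  and sufficient for them. The claims on the other three models need no such premise.\<close>

end

theory Submission
  imports Defs
begin

text \<open>A constant state solves the equation exactly when inflow equals outflow
  (\<open>stationary_states_iff\<close>). Measuring the queue in units of \<epsilon> leaves only the
  capacity \<open>K\<close> = \<Lambda>/\<epsilon> (\<open>stationary_states_scale\<close>), and the
  bound on \<epsilon> becomes \<delta>, \<sigma> \<le> \<open>K\<close>. The common flow is at most
  min \<delta> \<sigma>. In PQM1 and PQM3 the outflow, and in PQM4 the inflow, is also at least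
  that, so the flow equals min \<delta> \<sigma>, and the states can be read off
  (\<open>unit_stationary_states\<close>). In PQM2 a smaller flow would force
  \<open>l = K - l\<close>, hence flow \<open>K / 2\<close>; the premise 2 min \<delta> \<sigma>
  \<le> \<open>K\<close> excludes this.\<close>

lemma stationary_states_iff:
  "l \<in> stationary_states m \<Lambda> \<epsilon> \<delta> \<sigma> \<longleftrightarrow>
     l \<in> {0..\<Lambda>} \<and>
     min \<delta> (queue_supply m \<Lambda> \<epsilon> \<delta> \<sigma> l) = min (queue_demand m \<Lambda> \<epsilon> \<delta> \<sigma> l) \<sigma>"
  (is "_ \<longleftrightarrow> ?R")
proof
  assume "l \<in> stationary_states m \<Lambda> \<epsilon> \<delta> \<sigma>"
  then have sol: "pqm_solution m \<Lambda> \<epsilon> \<delta> \<sigma> (\<lambda>t. l)"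
    by (simp add: stationary_states_def)
  let ?D = "min \<delta> (queue_supply m \<Lambda> \<epsilon> \<delta> \<sigma> l) - min (queue_demand m \<Lambda> \<epsilon> \<delta> \<sigma> l) \<sigma>"
  \<comment> \<open>Time 1 is interior to the half-line, so the one-sided notion becomes the
    ordinary derivative there, which is unique and, for a constant, zero.\<close>
  have "((\<lambda>t. l) has_real_derivative ?D) (at 1 within {0..})"
    using sol unfolding pqm_solution_def by simp
  then have "((\<lambda>t. l) has_real_derivative ?D) (at 1 within {0<..})"
    by (rule has_field_derivative_subset) auto
  then have "((\<lambda>t. l) has_real_derivative ?D) (at 1)"
    by (simp add: at_within_open[of _ "{0<..}"])
  then have "?D = 0"
    using DERIV_const DERIV_unique by blast
  moreover have "l \<in> {0..\<Lambda>}"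
    using sol unfolding pqm_solution_def by blast
  ultimately show ?R by simp
next
  assume ?R
  then show "l \<in> stationary_states m \<Lambda> \<epsilon> \<delta> \<sigma>"
    by (simp add: stationary_states_def pqm_solution_def)
qed

text \<open>Substituting \<open>l = \<epsilon> * u\<close> turns \<open>l / \<epsilon>\<close> into
  \<open>u\<close> and \<open>(\<Lambda> - l) / \<epsilon>\<close> into \<open>K - u\<close>, while
  the rates \<delta> and \<sigma> stay as they are.\<close>

lemma stationary_states_scale:
  assumes "\<epsilon> > 0"
  shows "stationary_states m (\<epsilon> * K) \<epsilon> \<delta> \<sigma> = (*) \<epsilon> ` stationary_states m K 1 \<delta> \<sigma>"
proof -
  have mem: "\<epsilon> * u \<in> stationary_states m (\<epsilon> * K) \<epsilon> \<delta> \<sigma> \<longleftrightarrow> u \<in> stationary_states m K 1 \<delta> \<sigma>" for u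
  proof -
    have "(\<epsilon> * K - \<epsilon> * u) / \<epsilon> = K - u"
      using assms by (simp add: diff_divide_distrib)
    with assms show ?thesis
      by (cases m) (simp_all add: stationary_states_iff zero_le_mult_iff)
  qed
  show ?thesis
  proof (intro subset_antisym subsetI)
    fix l assume "l \<in> stationary_states m (\<epsilon> * K) \<epsilon> \<delta> \<sigma>"
    then show "l \<in> (*) \<epsilon> ` stationary_states m K 1 \<delta> \<sigma>"
      using mem[of "l / \<epsilon>"] assms by (intro image_eqI[of _ _ "l / \<epsilon>"]) simp_all
  qed (use mem in blast)
qed

text \<open>With flow min \<delta> \<sigma>, the smaller of the two rates fixes one of demand and
  supply, or bounds them if the rates agree. The bounds by \<open>K\<close> keep the resulting
  states in \<open>{0..K}\<close> and let them carry that flow. For PQM2 the state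
  \<open>K - \<sigma>\<close> or \<open>\<delta>\<close> must leave room for both demand and supply,
  which again takes 2 min \<delta> \<sigma> \<le> \<open>K\<close>.\<close>

lemma unit_stationary_states:
  assumes "0 \<le> \<delta>" "0 \<le> \<sigma>" "\<delta> \<le> K" "\<sigma> \<le> K"
  shows
    "stationary_states PQM1 K 1 \<delta> \<sigma> =
      (if \<delta> > \<sigma> then {K} else if \<delta> < \<sigma> then {0} else {0..K})"
    "2 * min \<delta> \<sigma> \<le> K \<Longrightarrow> stationary_states PQM2 K 1 \<delta> \<sigma> =
      (if \<delta> > \<sigma> then {K - \<sigma>} else if \<delta> < \<sigma> then {\<delta>} else {\<delta>..K - \<sigma>})"
    "stationary_states PQM3 K 1 \<delta> \<sigma> =
      (if \<delta> > \<sigma> then {K - \<sigma>} else if \<delta> < \<sigma> then {0} else {0..K - \<sigma>})"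
    "stationary_states PQM4 K 1 \<delta> \<sigma> =
      (if \<delta> > \<sigma> then {K} else if \<delta> < \<sigma> then {\<delta>} else {\<delta>..K})"
  using assms by (auto simp: set_eq_iff stationary_states_iff min_def split: if_splits)

theorem theorem5p6:
  fixes \<Lambda> \<epsilon> \<delta> \<sigma> :: real
  assumes "\<Lambda> > 0" and "\<delta> \<ge> 0" and "\<sigma> \<ge> 0"
    and "\<epsilon> > 0"
    and "max \<delta> \<sigma> > 0 \<Longrightarrow> \<epsilon> \<le> \<Lambda> / max \<delta> \<sigma>"
  shows "(\<delta> > \<sigma> \<longrightarrow>
            stationary_states PQM1 \<Lambda> \<epsilon> \<delta> \<sigma> = {\<Lambda>} \<and>
            stationary_states PQM4 \<Lambda> \<epsilon> \<delta> \<sigma> = {\<Lambda>} \<and>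
            (2 * \<epsilon> * min \<delta> \<sigma> \<le> \<Lambda> \<longrightarrow>
               stationary_states PQM2 \<Lambda> \<epsilon> \<delta> \<sigma> = {\<Lambda> - \<epsilon> * \<sigma>}) \<and>
            stationary_states PQM3 \<Lambda> \<epsilon> \<delta> \<sigma> = {\<Lambda> - \<epsilon> * \<sigma>}) \<and>
         (\<delta> < \<sigma> \<longrightarrow>
            stationary_states PQM1 \<Lambda> \<epsilon> \<delta> \<sigma> = {0} \<and>
            stationary_states PQM3 \<Lambda> \<epsilon> \<delta> \<sigma> = {0} \<and>
            (2 * \<epsilon> * min \<delta> \<sigma> \<le> \<Lambda> \<longrightarrow>
               stationary_states PQM2 \<Lambda> \<epsilon> \<delta> \<sigma> = {\<epsilon> * \<delta>}) \<and>
            stationary_states PQM4 \<Lambda> \<epsilon> \<delta> \<sigma> = {\<epsilon> * \<delta>}) \<and>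
         (\<delta> = \<sigma> \<longrightarrow>
            stationary_states PQM1 \<Lambda> \<epsilon> \<delta> \<sigma> = {0..\<Lambda>} \<and>
            (2 * \<epsilon> * min \<delta> \<sigma> \<le> \<Lambda> \<longrightarrow>
               stationary_states PQM2 \<Lambda> \<epsilon> \<delta> \<sigma> = {\<epsilon> * \<delta>..\<Lambda> - \<epsilon> * \<sigma>}) \<and>
            stationary_states PQM3 \<Lambda> \<epsilon> \<delta> \<sigma> = {0..\<Lambda> - \<epsilon> * \<sigma>} \<and>
            stationary_states PQM4 \<Lambda> \<epsilon> \<delta> \<sigma> = {\<epsilon> * \<delta>..\<Lambda>})"
proof -
  define K where "K = \<Lambda> / \<epsilon>"
  have \<Lambda>: "\<Lambda> = \<epsilon> * K"
    using assms(4) by (simp add: K_def)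
  have "K > 0"
    using assms(1,4) by (simp add: K_def)
  have K: "\<delta> \<le> K" "\<sigma> \<le> K"
  proof -
    have "max \<delta> \<sigma> \<le> K"
    proof (cases "max \<delta> \<sigma> > 0")
      case True
      with assms(5)[OF True] assms(4) show ?thesis
        by (simp only: K_def pos_le_divide_eq mult.commute)
    next
      \<comment> \<open>Both rates vanish here, so the guarded bound on \<epsilon> says nothing and
        positivity of \<open>K\<close> takes its place.\<close>
      case False
      with \<open>K > 0\<close> show ?thesis by linarith
    qed
    then show "\<delta> \<le> K" "\<sigma> \<le> K" by auto
  qed
  have cap: "2 * \<epsilon> * min \<delta> \<sigma> \<le> \<Lambda> \<longleftrightarrow> 2 * min \<delta> \<sigma> \<le> K"
    using assms(4) by (simp add: K_def pos_le_divide_eq mult_ac)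
  note unit_states = unit_stationary_states[OF assms(2,3) K]
  show ?thesis
    \<comment> \<open>\<open>cap\<close> must be applied while \<Lambda> still occurs literally in
      the goal. Afterwards each set is an image under scaling by \<epsilon> > 0, which maps
      intervals to intervals.\<close>
    unfolding cap unfolding \<Lambda> stationary_states_scale[OF assms(4)]
    using unit_states assms(4) \<open>K > 0\<close>
    by (cases \<delta> \<sigma> rule: linorder_cases) (simp_all add: right_diff_distrib)
qed

end
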